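(* Let $0<a_1<\dots<a_n$ be real numbers, $u=\lceil n/2\rceil$, $u'=\lfloor n/2\rfloor$. Suppose $\vec{C}^*=(c^*_1,\dots,c^*_n)$ is an optimal ordering of $a_1,\dots,a_n$ with $c_1^*=a_1$ and $c_n^*=a_2$. Then: (1) if $n$ is even, $c^*_{n+2-k}<c^*_k<c^*_{n+1-k}$ for all $2\le k\le u$; (2) if $n$ is odd, $c^*_k<c^*_{n+1-k}$ for all $2\le k\le u'$ and $c^*_{n+2-k}<c^*_k$ for all $2\le k\le u$.
   Context: For an ordering $\vec{C}=(c_1,\dots,c_n)$ of $a_1,\dots,a_n$, its partial sums are $s_k=\sum_{i=1}^k c_i$, with mean $\overline{S}=\frac1n\sum_{k=1}^n s_k$, and $f(\vec{C})=\frac1n\sum_{k=1}^n (s_k-\overline{S})^2$. An ordering is optimal if it maximizes $f$ over all orderings of $a_1,\dots,a_n$. *)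

theory Defs
  imports Complex_Main "HOL-Combinatorics.Permutations"
begin

(* A finite sequence x_1, ..., x_n is a function on nat of which only the values
   at 1, ..., n matter. *)

definition is_ordering :: "nat \<Rightarrow> (nat \<Rightarrow> real) \<Rightarrow> (nat \<Rightarrow> real) \<Rightarrow> bool" where
  "is_ordering n a c \<longleftrightarrow> (\<exists>p. p permutes {1..n} \<and> (\<forall>i\<in>{1..n}. c i = a (p i)))"

definition partial_sum :: "(nat \<Rightarrow> real) \<Rightarrow> nat \<Rightarrow> real" where
  "partial_sum c k = (\<Sum>i=1..k. c i)"

definition mean_partial_sum :: "nat \<Rightarrow> (nat \<Rightarrow> real) \<Rightarrow> real" where
  "mean_partial_sum n c = 1 / real n * (\<Sum>k=1..n. partial_sum c k)"

definition var_partial_sum :: "nat \<Rightarrow> (nat \<Rightarrow> real) \<Rightarrow> real" where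
  "var_partial_sum n c =
     1 / real n * (\<Sum>k=1..n. (partial_sum c k - mean_partial_sum n c)\<^sup>2)"

definition optimal_ordering :: "nat \<Rightarrow> (nat \<Rightarrow> real) \<Rightarrow> (nat \<Rightarrow> real) \<Rightarrow> bool" where
  "optimal_ordering n a c \<longleftrightarrow>
     is_ordering n a c \<and>
     (\<forall>d. is_ordering n a d \<longrightarrow> var_partial_sum n d \<le> var_partial_sum n c)"

end

theory Submission
  imports Defs
begin

text \<open>
  Up to a factor \<open>1 / n\<^sup>2\<close> the variance of the partial sums is the quadratic form with kernel
  \<open>K i j = (n + 1 - max i j) (min i j - 1)\<close>. For each of the two reflections
  \<open>i \<mapsto> n + 1 - i\<close> on \<open>{1..n}\<close> and \<open>i \<mapsto> n + 2 - i\<close> on \<open>{2..n}\<close> we polarize the ordering: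
  within each pair of reflected positions the larger entry is moved to a fixed half, the upper
  one for the first reflection and the lower one for the second. The kernel is such that
  this never decreases the form. It increases the form strictly if, for the first
  reflection, any pair was in the wrong order, and, for the second one, if some but not all pairs
  were; as \<open>c n = a 2\<close> is smaller than \<open>c 2\<close>, the pair \<open>{2, n}\<close> always is in the right order.
\<close>

section \<open>The variance of the partial sums as a quadratic form\<close>

definition quad_form :: "'a set \<Rightarrow> ('a \<Rightarrow> 'a \<Rightarrow> real) \<Rightarrow> ('a \<Rightarrow> real) \<Rightarrow> real" where
  "quad_form I K x = (\<Sum>i\<in>I. \<Sum>j\<in>I. K i j * (x i * x j))"

text \<open>Divided by \<open>n^2\<close>, this is the covariance of a Brownian bridge at the times
  \<open>(i - 1) / n\<close> and \<open>(j - 1) / n\<close>.\<close>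

definition bridge_kernel :: "nat \<Rightarrow> nat \<Rightarrow> nat \<Rightarrow> real" where
  "bridge_kernel n i j = (real n + 1 - real (max i j)) * (real (min i j) - 1)"

lemma bridge_kernel_commute: "bridge_kernel n i j = bridge_kernel n j i"
  by (simp add: bridge_kernel_def max.commute min.commute)

lemma bridge_kernel_le:
  "i \<le> j \<Longrightarrow> bridge_kernel n i j = (real n + 1 - real j) * (real i - 1)"
  by (simp add: bridge_kernel_def)

text \<open>With \<open>M\<close> the sum of all partial sums, the left side is \<open>n\<close>
  times the sum of their squares minus \<open>M * M\<close>. There \<open>c i * c j\<close> has the
  coefficient \<open>n * (n + 1 - max i j) - (n + 1 - i) * (n + 1 - j)\<close>, which factors as the
  kernel since \<open>{i, j} = {max i j, min i j}\<close>.\<close>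

lemma var_partial_sum_eq_quad_form:
  assumes "n > 0"
  shows "(real n)\<^sup>2 * var_partial_sum n c = quad_form {1..n} (bridge_kernel n) c"
proof -
  let ?I = "{1..n}"
  \<comment> \<open>The indicator lets every partial sum range over all of \<open>{1..n}\<close>, so
    that sums can be swapped.\<close>
  let ?e = "\<lambda>i k. if i \<le> k then 1 else 0 :: real"
  define M where "M = (\<Sum>k\<in>?I. partial_sum c k)"
  have s: "partial_sum c k = (\<Sum>i\<in>?I. ?e i k * c i)" if "k \<in> ?I" for k
  proof -
    have "partial_sum c k = (\<Sum>i\<in>{1..k}. ?e i k * c i)"
      by (simp add: partial_sum_def)
    also have "\<dots> = (\<Sum>i\<in>?I. ?e i k * c i)"
      using that by (intro sum.mono_neutral_left) auto
    finally show ?thesis .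
  qed
  have count: "(\<Sum>k\<in>?I. ?e i k) = real n + 1 - real i" if "i \<in> ?I" for i
  proof -
    have "(\<Sum>k\<in>?I. ?e i k) = (\<Sum>k\<in>{i..n}. ?e i k)"
      using that by (intro sum.mono_neutral_right) auto
    then show ?thesis using that by (simp add: of_nat_diff)
  qed
  have M: "M = (\<Sum>i\<in>?I. (real n + 1 - real i) * c i)"
  proof -
    have "M = (\<Sum>k\<in>?I. \<Sum>i\<in>?I. ?e i k * c i)"
      unfolding M_def by (intro sum.cong refl s)
    also have "\<dots> = (\<Sum>i\<in>?I. (\<Sum>k\<in>?I. ?e i k) * c i)"
      by (subst sum.swap) (simp only: sum_distrib_right)
    finally show ?thesis by (simp only: count cong: sum.cong)
  qed
  have sq: "(\<Sum>k\<in>?I. (partial_sum c k)\<^sup>2)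
      = (\<Sum>i\<in>?I. \<Sum>j\<in>?I. (real n + 1 - real (max i j)) * (c i * c j))"
  proof -
    have "(\<Sum>k\<in>?I. (partial_sum c k)\<^sup>2)
        = (\<Sum>k\<in>?I. \<Sum>i\<in>?I. \<Sum>j\<in>?I. ?e (max i j) k * (c i * c j))"
    proof (intro sum.cong refl)
      fix k assume "k \<in> ?I"
      then have "(partial_sum c k)\<^sup>2 = (\<Sum>i\<in>?I. \<Sum>j\<in>?I. (?e i k * c i) * (?e j k * c j))"
        by (simp only: s power2_eq_square sum_product)
      also have "\<dots> = (\<Sum>i\<in>?I. \<Sum>j\<in>?I. ?e (max i j) k * (c i * c j))"
        by (intro sum.cong refl) simp
      finally show "(partial_sum c k)\<^sup>2 = \<dots>" .
    qed
    also have "\<dots> = (\<Sum>i\<in>?I. \<Sum>k\<in>?I. \<Sum>j\<in>?I. ?e (max i j) k * (c i * c j))"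
      by (rule sum.swap)
    also have "\<dots> = (\<Sum>i\<in>?I. \<Sum>j\<in>?I. \<Sum>k\<in>?I. ?e (max i j) k * (c i * c j))"
      by (intro sum.cong refl sum.swap)
    also have "\<dots> = (\<Sum>i\<in>?I. \<Sum>j\<in>?I. (real n + 1 - real (max i j)) * (c i * c j))"
    proof (intro sum.cong refl)
      fix i j assume "i \<in> ?I" "j \<in> ?I"
      then have "max i j \<in> ?I" by auto
      from count[OF this]
      show "(\<Sum>k\<in>?I. ?e (max i j) k * (c i * c j)) = (real n + 1 - real (max i j)) * (c i * c j)"
        by (simp only: sum_distrib_right[symmetric])
    qed
    finally show ?thesis .
  qed
  have "(real n)\<^sup>2 * var_partial_sum n c
      = real n * (\<Sum>k\<in>?I. (partial_sum c k)\<^sup>2 - 2 * partial_sum c k * (M / n) + (M / n)\<^sup>2)"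
    using assms by (simp add: var_partial_sum_def mean_partial_sum_def M_def power2_eq_square
        algebra_simps)
  also have "\<dots> = real n * ((\<Sum>k\<in>?I. (partial_sum c k)\<^sup>2) - 2 * M * (M / n) + n * (M / n)\<^sup>2)"
    by (simp add: sum.distrib sum_subtractf sum_distrib_left[symmetric] sum_distrib_right[symmetric]
        M_def sum_divide_distrib[symmetric])
  also have "\<dots> = real n * (\<Sum>k\<in>?I. (partial_sum c k)\<^sup>2) - M * M"
    using assms by (simp add: power2_eq_square field_simps)
  also have "\<dots> = (\<Sum>i\<in>?I. \<Sum>j\<in>?I. real n * ((real n + 1 - real (max i j)) * (c i * c j))
      - ((real n + 1 - real i) * c i) * ((real n + 1 - real j) * c j))"
    unfolding sq M sum_product by (simp only: sum_distrib_left sum_subtractf)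
  also have "\<dots> = quad_form ?I (bridge_kernel n) c"
    unfolding quad_form_def
    by (intro sum.cong refl) (auto simp: bridge_kernel_def max_def min_def algebra_simps)
  finally show ?thesis .
qed

section \<open>Polarization along an involution\<close>

text \<open>By \<open>cover\<close> and \<open>fold\<close>, \<open>H\<close> contains exactly one
  point of each orbit of \<open>\<sigma>\<close> in \<open>I\<close>, fixed points included.\<close>

locale folding =
  fixes I :: "'a set" and \<sigma> :: "'a \<Rightarrow> 'a" and H :: "'a set"
  assumes finite: "finite I"
    and closed: "i \<in> I \<Longrightarrow> \<sigma> i \<in> I"
    and involution: "\<sigma> (\<sigma> i) = i"
    and fixed: "i \<notin> I \<Longrightarrow> \<sigma> i = i"
    and cover: "i \<in> I \<Longrightarrow> i \<in> H \<or> \<sigma> i \<in> H"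
    and fold: "i \<in> H \<Longrightarrow> \<sigma> i \<in> H \<Longrightarrow> \<sigma> i = i"
begin

definition polarize :: "('a \<Rightarrow> real) \<Rightarrow> 'a \<Rightarrow> real" where
  "polarize x i = (if i \<in> H then max (x i) (x (\<sigma> i)) else min (x i) (x (\<sigma> i)))"

lemma polarize_half:
  assumes "i \<in> H"
  shows "polarize x i = max (x i) (x (\<sigma> i))" and "polarize x (\<sigma> i) = min (x i) (x (\<sigma> i))"
  using assms fold[of i] by (auto simp: polarize_def involution min.commute)

lemma polarize_eq_permute:
  obtains \<tau> where "\<tau> permutes I" and "\<And>i. polarize x i = x (\<tau> i)"
proof
  define \<tau> where "\<tau> i = (if i \<in> H \<and> x i < x (\<sigma> i) \<or> i \<notin> H \<and> x (\<sigma> i) < x i then \<sigma> i else i)" for i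
  have fix_out: "\<tau> i = i" if "i \<notin> I" for i
    using that by (simp add: \<tau>_def fixed)
  \<comment> \<open>Both points of a pair decide alike whether to swap.\<close>
  have inv: "\<tau> (\<tau> i) = i" for i
    using fold[of i] cover[of i] fixed[of i] by (auto simp: \<tau>_def involution)
  show "\<tau> permutes I"
    unfolding permutes_def using fix_out inv by metis
  show "polarize x i = x (\<tau> i)" for i
    by (auto simp: polarize_def \<tau>_def)
qed

definition gain :: "('a \<Rightarrow> 'a \<Rightarrow> real) \<Rightarrow> ('a \<Rightarrow> real) \<Rightarrow> 'a \<Rightarrow> 'a \<Rightarrow> real" where
  "gain K x i j = K i j * (polarize x i * polarize x j - x i * x j)"

text \<open>Averaging over the four reflections of a pair of indices: only the sum of the four gains is
  nonnegative, not each gain by itself.\<close>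

definition orbit_gain :: "('a \<Rightarrow> 'a \<Rightarrow> real) \<Rightarrow> ('a \<Rightarrow> real) \<Rightarrow> 'a \<Rightarrow> 'a \<Rightarrow> real" where
  "orbit_gain K x i j = gain K x i j + gain K x (\<sigma> i) j + gain K x i (\<sigma> j) + gain K x (\<sigma> i) (\<sigma> j)"

lemma orbit_gain_reflect:
  "orbit_gain K x (\<sigma> i) j = orbit_gain K x i j" "orbit_gain K x i (\<sigma> j) = orbit_gain K x i j"
  by (simp_all add: orbit_gain_def involution)

lemma sum_reflect: "(\<Sum>i\<in>I. f (\<sigma> i)) = (\<Sum>i\<in>I. f i)"
  by (rule sum.reindex_bij_witness[of _ \<sigma> \<sigma>]) (auto simp: involution closed)

text \<open>Reindexing by \<open>\<sigma>\<close> shows that the four terms of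
  \<open>orbit_gain\<close> have equal totals, hence the factor 4.\<close>

lemma quad_form_polarize:
  "4 * (quad_form I K (polarize x) - quad_form I K x) = (\<Sum>i\<in>I. \<Sum>j\<in>I. orbit_gain K x i j)"
proof -
  have "quad_form I K (polarize x) - quad_form I K x = (\<Sum>i\<in>I. \<Sum>j\<in>I. gain K x i j)"
    by (simp add: quad_form_def gain_def sum_subtractf right_diff_distrib)
  moreover have "(\<Sum>i\<in>I. \<Sum>j\<in>I. gain K x (\<sigma> i) j) = (\<Sum>i\<in>I. \<Sum>j\<in>I. gain K x i j)"
    by (rule sum_reflect)
  moreover have "(\<Sum>i\<in>I. \<Sum>j\<in>I. gain K x i (\<sigma> j)) = (\<Sum>i\<in>I. \<Sum>j\<in>I. gain K x i j)"
    by (intro sum.cong refl sum_reflect)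
  moreover have "(\<Sum>i\<in>I. \<Sum>j\<in>I. gain K x (\<sigma> i) (\<sigma> j)) = (\<Sum>i\<in>I. \<Sum>j\<in>I. gain K x i j)"
    by (subst sum_reflect) (intro sum.cong refl sum_reflect)
  ultimately show ?thesis
    by (simp add: orbit_gain_def sum.distrib)
qed

end

section \<open>Kernels for which polarization never decreases the form\<close>

text \<open>Here \<open>a, a'\<close> and \<open>b, b'\<close> are the entries of two pairs, the
  unprimed ones in \<open>H\<close>, and \<open>S, R, Q, P\<close> are the kernel values at
  \<open>(i, j)\<close>, \<open>(\<sigma> i, j)\<close>, \<open>(i, \<sigma> j)\<close>,
  \<open>(\<sigma> i, \<sigma> j)\<close>. In each case the gain is written as a combination of
  products that the hypotheses make nonnegative.\<close>

lemma two_point_gain: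
  fixes P Q R S a a' b b' :: real
  assumes "Q \<le> S" "R \<le> S" "\<bar>Q - R\<bar> \<le> S - P"
    and nonneg: "0 \<le> a" "0 \<le> a'" "0 \<le> b" "0 \<le> b'"
  shows "S * (a * b) + R * (a' * b) + Q * (a * b') + P * (a' * b')
    \<le> S * (max a a' * max b b') + R * (min a a' * max b b')
      + Q * (max a a' * min b b') + P * (min a a' * min b b')"
proof -
  have d: "0 \<le> S - P + Q - R" "0 \<le> S - P + R - Q" "0 \<le> S - Q" "0 \<le> S - R"
    using assms by auto
  consider "a' \<le> a" "b' \<le> b" | "a \<le> a'" "b' \<le> b" | "a' \<le> a" "b \<le> b'" | "a \<le> a'" "b \<le> b'"
    by linarith
  then show ?thesis
  proof cases
    case 1
    then show ?thesis by simp
  next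
    case 2
    \<comment> \<open>This is the gain. \<open>Q - P\<close> may be negative, so
      \<open>(S - R) * b + (Q - P) * b'\<close> is regrouped around \<open>b - b'\<close>.\<close>
    have "0 \<le> (a' - a) * ((S - R) * (b - b') + (S - P + Q - R) * b')"
      using 2 d nonneg by simp
    with 2 show ?thesis by (simp add: algebra_simps)
  next
    case 3
    have "0 \<le> (b' - b) * ((S - Q) * (a - a') + (S - P + R - Q) * a')"
      using 3 d nonneg by simp
    with 3 show ?thesis by (simp add: algebra_simps)
  next
    case 4
    have "0 \<le> (S - P) * ((a' - a) * (b' - b))"
      using 4 d by simp
    moreover have "0 \<le> (S - P + Q - R) * ((a' - a) * b)" "0 \<le> (S - P + R - Q) * ((b' - b) * a)"
      using 4 d nonneg by simp_all
    ultimately show ?thesis using 4 by (simp add: algebra_simps)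
  qed
qed

text \<open>The two inequalities are the hypotheses of \<open>two_point_gain\<close> for
  representatives in \<open>H\<close>; by \<open>commute\<close>, \<open>reflect_le\<close> also
  bounds \<open>K i (\<sigma> j)\<close>.\<close>

locale folded_kernel = folding +
  fixes K :: "'a \<Rightarrow> 'a \<Rightarrow> real"
  assumes commute: "K i j = K j i"
    and reflect_le: "i \<in> I \<Longrightarrow> j \<in> I \<Longrightarrow> i \<in> H \<Longrightarrow> j \<in> H \<Longrightarrow> K (\<sigma> i) j \<le> K i j"
    and reflect_diff: "i \<in> I \<Longrightarrow> j \<in> I \<Longrightarrow> i \<in> H \<Longrightarrow> j \<in> H \<Longrightarrow>
      \<bar>K i (\<sigma> j) - K (\<sigma> i) j\<bar> \<le> K i j - K (\<sigma> i) (\<sigma> j)"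
begin

lemma orbit_gain_nonneg:
  assumes "i \<in> I" "j \<in> I" and x: "\<And>i. i \<in> I \<Longrightarrow> 0 \<le> x i"
  shows "0 \<le> orbit_gain K x i j"
proof -
  have half: "0 \<le> orbit_gain K x i j" if "i \<in> I" "j \<in> I" "i \<in> H" "j \<in> H" for i j
  proof -
    have "K i (\<sigma> j) \<le> K i j"
      using reflect_le[of j i] that by (simp add: commute)
    then show ?thesis
      using two_point_gain[of "K i (\<sigma> j)" "K i j" "K (\<sigma> i) j" "K (\<sigma> i) (\<sigma> j)"
          "x i" "x (\<sigma> i)" "x j" "x (\<sigma> j)"]
        reflect_le[of i j] reflect_diff[of i j] that closed x
      by (simp add: orbit_gain_def gain_def polarize_half right_diff_distrib)
  qed
  \<comment> \<open>Reflecting an index does not change \<open>orbit_gain\<close>, so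
    representatives in \<open>H\<close> suffice.\<close>
  obtain i' where "i' \<in> I" "i' \<in> H" "i' = i \<or> i' = \<sigma> i"
    using cover closed assms by metis
  moreover obtain j' where "j' \<in> I" "j' \<in> H" "j' = j \<or> j' = \<sigma> j"
    using cover closed assms by metis
  ultimately show ?thesis
    using half[of i' j'] by (auto simp: orbit_gain_reflect)
qed

lemma quad_form_polarize_less:
  assumes x: "\<And>i. i \<in> I \<Longrightarrow> 0 \<le> x i"
    and ij: "i \<in> I" "j \<in> I" "0 < orbit_gain K x i j"
  shows "quad_form I K x < quad_form I K (polarize x)"
proof -
  have row: "0 < (\<Sum>j\<in>I. orbit_gain K x i j)"
    using ij x finite by (intro sum_pos2[of _ j]) (auto intro: orbit_gain_nonneg)
  have "0 < (\<Sum>i\<in>I. \<Sum>j\<in>I. orbit_gain K x i j)"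
    by (rule sum_pos2[where i = i, OF finite ij(1)]) (use row x in \<open>auto intro!: orbit_gain_nonneg sum_nonneg\<close>)
  then show ?thesis
    by (simp only: quad_form_polarize[symmetric]) simp
qed

text \<open>On the diagonal the cross terms cancel, since swapping keeps
  \<open>x i * x (\<sigma> i)\<close>; what is left is the difference of the squares, weighted by
  \<open>K i i - K (\<sigma> i) (\<sigma> i)\<close>.\<close>

lemma less_polarize_of_wrong_pair:
  assumes x: "\<And>i. i \<in> I \<Longrightarrow> 0 < x i"
    and i: "i \<in> I" "i \<in> H" "x i < x (\<sigma> i)" and less: "K (\<sigma> i) (\<sigma> i) < K i i"
  shows "quad_form I K x < quad_form I K (polarize x)"
proof (rule quad_form_polarize_less[of x i i])
  have "orbit_gain K x i i = (K i i - K (\<sigma> i) (\<sigma> i)) * ((x (\<sigma> i) - x i) * (x (\<sigma> i) + x i))"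
    using i by (simp add: orbit_gain_def gain_def polarize_half commute[of "\<sigma> i" i] algebra_simps)
  moreover have "0 < x i" "0 < x (\<sigma> i)" using x i closed by auto
  ultimately show "0 < orbit_gain K x i i"
    using i less by simp
qed (use x i in \<open>auto intro: less_imp_le\<close>)

text \<open>If the kernel does not change when both indices are reflected, only the relative
  orientation of two pairs matters, so a wrong pair is compared with a right one.\<close>

lemma less_polarize_of_mixed_pairs:
  assumes x: "\<And>i. i \<in> I \<Longrightarrow> 0 < x i"
    and i: "i \<in> I" "i \<in> H" "x (\<sigma> i) < x i" and j: "j \<in> I" "j \<in> H" "x j < x (\<sigma> j)"
    and invariant: "K (\<sigma> i) (\<sigma> j) = K i j" and less: "K (\<sigma> i) j < K i j"
  shows "quad_form I K x < quad_form I K (polarize x)"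
proof (rule quad_form_polarize_less[of x i j])
  \<comment> \<open>Invariance makes the right side of \<open>reflect_diff\<close> zero.\<close>
  have "K i (\<sigma> j) = K (\<sigma> i) j"
    using reflect_diff[of i j] invariant i j by simp
  then have "orbit_gain K x i j = (K i j - K (\<sigma> i) j) * ((x i - x (\<sigma> i)) * (x (\<sigma> j) - x j))"
    using i j invariant by (simp add: orbit_gain_def gain_def polarize_half algebra_simps)
  then show "0 < orbit_gain K x i j"
    using i j less by simp
qed (use x i j in \<open>auto intro: less_imp_le\<close>)

end

section \<open>Comparison of an optimal ordering with its polarizations\<close>

lemma optimal_ordering_not_less_polarize:
  assumes "folding {1..n} \<sigma> H" and opt: "optimal_ordering n a c"
  shows "\<not> quad_form {1..n} (bridge_kernel n) c
    < quad_form {1..n} (bridge_kernel n) (folding.polarize \<sigma> H c)"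
proof (cases "n = 0")
  case True
  then show ?thesis by (simp add: quad_form_def)
next
  case False
  interpret folding "{1..n}" \<sigma> H by fact
  obtain p where p: "p permutes {1..n}" "\<And>i. i \<in> {1..n} \<Longrightarrow> c i = a (p i)"
    using opt by (auto simp: optimal_ordering_def is_ordering_def)
  obtain \<tau> where \<tau>: "\<tau> permutes {1..n}" "\<And>i. polarize c i = c (\<tau> i)"
    using polarize_eq_permute[of c] by blast
  have "(p \<circ> \<tau>) permutes {1..n}"
    using \<tau> p by (simp add: permutes_compose)
  moreover have "polarize c i = a ((p \<circ> \<tau>) i)" if "i \<in> {1..n}" for i
    using p(2)[of "\<tau> i"] permutes_in_image[OF \<tau>(1), of i] that by (simp add: \<tau>(2))
  ultimately have "is_ordering n a (polarize c)"
    unfolding is_ordering_def by blast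
  then have "var_partial_sum n (polarize c) \<le> var_partial_sum n c"
    using opt by (simp add: optimal_ordering_def)
  then have "(real n)\<^sup>2 * var_partial_sum n (polarize c) \<le> (real n)\<^sup>2 * var_partial_sum n c"
    by (rule mult_left_mono) simp
  then show ?thesis
    using False by (simp add: var_partial_sum_eq_quad_form)
qed

section \<open>The bridge kernel under the two reflections\<close>

text \<open>The reflections used have \<open>l = 1\<close> and \<open>l = 2\<close>; the latter
  fixes position 1.\<close>

definition reflect :: "nat \<Rightarrow> nat \<Rightarrow> nat \<Rightarrow> nat" where
  "reflect l n i = (if i \<in> {l..n} then n + l - i else i)"

text \<open>With \<open>s\<close>, \<open>t\<close> the reflections of \<open>i\<close>,
  \<open>j\<close>, one has \<open>K i j - K s t = i + j - n - 1\<close> and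
  \<open>K i t - K s j = i - j\<close>; so the second bound amounts to
  \<open>n + 1 \<le> 2 * min i j\<close>.\<close>

lemma folded_kernel_upper_half:
  "folded_kernel {1..n} (reflect 1 n) {i. n + 1 \<le> 2 * i} (bridge_kernel n)"
proof
  show "bridge_kernel n i j = bridge_kernel n j i" for i j
    by (rule bridge_kernel_commute)
  fix i j
  assume "i \<in> {1..n}" "j \<in> {1..n}" "i \<in> {i. n + 1 \<le> 2 * i}" "j \<in> {i. n + 1 \<le> 2 * i}"
  then have i: "1 \<le> i" "i \<le> n" "n + 1 \<le> 2 * i" and j: "1 \<le> j" "j \<le> n" "n + 1 \<le> 2 * j"
    by auto
  define s t where "s = reflect 1 n i" and "t = reflect 1 n j"
  have st: "s = n + 1 - i" "t = n + 1 - j"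
    using i j by (auto simp: s_def t_def reflect_def)
  have r: "real s = real n + 1 - real i" "real t = real n + 1 - real j"
    using i j by (auto simp: st of_nat_diff)
  \<comment> \<open>As \<open>s\<close> and \<open>t\<close> lie below both \<open>i\<close> and
    \<open>j\<close>, the mixed kernel values have the same form in either order of \<open>i\<close>
    and \<open>j\<close>.\<close>
  have le: "s \<le> i" "s \<le> j" "t \<le> i" "t \<le> j"
    using i j by (auto simp: st)
  have K: "bridge_kernel n s j = (real n + 1 - real j) * (real n - real i)"
    "bridge_kernel n i t = (real n + 1 - real i) * (real n - real j)"
    using le bridge_kernel_le[of s j n] bridge_kernel_le[of t i n]
    by (simp_all add: bridge_kernel_commute[of n i t] r)
  have half: "0 \<le> 2 * real i - real n - 1" "0 \<le> 2 * real j - real n - 1"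
    "0 \<le> real n - real i" "0 \<le> real n - real j"
    using i j by linarith+
  consider "i \<le> j" | "j \<le> i" by linarith
  then have "bridge_kernel n s j \<le> bridge_kernel n i j
    \<and> \<bar>bridge_kernel n i t - bridge_kernel n s j\<bar> \<le> bridge_kernel n i j - bridge_kernel n s t"
  proof cases
    case 1
    then have "t \<le> s" by (simp add: st)
    with 1 have "bridge_kernel n i j = (real n + 1 - real j) * (real i - 1)"
      "bridge_kernel n s t = real i * (real n - real j)"
      using bridge_kernel_le[of i j n] bridge_kernel_le[of t s n]
      by (simp_all add: bridge_kernel_commute[of n s t] r)
    \<comment> \<open>This product is \<open>K i j - K s j\<close>.\<close>
    moreover have "0 \<le> (2 * real i - real n - 1) * (real n + 1 - real j)"
      using half by simp
    ultimately show ?thesis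
      using half unfolding K by (simp add: algebra_simps abs_le_iff)
  next
    case 2
    then have "s \<le> t" by (simp add: st)
    with 2 have "bridge_kernel n i j = (real n + 1 - real i) * (real j - 1)"
      "bridge_kernel n s t = real j * (real n - real i)"
      using bridge_kernel_le[of j i n] bridge_kernel_le[of s t n]
      by (simp_all add: bridge_kernel_commute[of n i j] r)
    \<comment> \<open>Here \<open>K i j - K s j\<close> is this expression plus
      \<open>2 * j - n - 1\<close>.\<close>
    moreover have "0 \<le> (2 * real j - real n - 1) * (real n - real i) + (real i - real j)"
      using half 2 by simp
    ultimately show ?thesis
      using half unfolding K by (simp add: algebra_simps abs_le_iff)
  qed
  then show "bridge_kernel n (reflect 1 n i) j \<le> bridge_kernel n i j"
    and "\<bar>bridge_kernel n i (reflect 1 n j) - bridge_kernel n (reflect 1 n i) j\<bar>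
      \<le> bridge_kernel n i j - bridge_kernel n (reflect 1 n i) (reflect 1 n j)"
    by (auto simp: s_def t_def)
qed (auto simp: reflect_def)

lemma bridge_kernel_Suc_0 [simp]: "j \<ge> Suc 0 \<Longrightarrow> bridge_kernel n (Suc 0) j = 0"
  by (simp add: bridge_kernel_le)

lemma reflect_cases:
  assumes "i \<in> {1..n}"
  obtains "i = 1" "reflect 2 n i = 1"
    | "2 \<le> i" "2 \<le> reflect 2 n i" "real (reflect 2 n i) = real n + 2 - real i"
  using assms by (cases "i = 1") (auto simp: reflect_def of_nat_diff)

text \<open>The map \<open>i \<mapsto> n + 2 - i\<close> exchanges the distances to \<open>1\<close>
  and to \<open>n + 1\<close>, hence the two factors of the kernel. Position 1 is fixed instead, and
  there the kernel vanishes.\<close>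

lemma bridge_kernel_reflect_reflect:
  assumes "i \<in> {1..n}" "j \<in> {1..n}"
  shows "bridge_kernel n (reflect 2 n i) (reflect 2 n j) = bridge_kernel n i j"
  using assms(1)
proof (cases rule: reflect_cases)
  case i: 2
  from assms(2) show ?thesis
  proof (cases rule: reflect_cases)
    case j: 2
    consider "i \<le> j" "reflect 2 n j \<le> reflect 2 n i" | "j \<le> i" "reflect 2 n i \<le> reflect 2 n j"
      using i(3) j(3) by linarith
    then show ?thesis
    proof cases
      case 1
      then show ?thesis
        by (simp add: bridge_kernel_commute[of n "reflect 2 n i"] bridge_kernel_le i(3) j(3))
    next
      case 2
      then show ?thesis
        by (simp add: bridge_kernel_commute[of n i] bridge_kernel_le i(3) j(3))
    qed
  qed (use i in \<open>simp add: bridge_kernel_commute[of n _ "Suc 0"]\<close>)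
next
  case 1
  have "Suc 0 \<le> reflect 2 n j"
    using assms(2) by (auto simp: reflect_def)
  with 1 assms(2) show ?thesis by simp
qed

lemma bridge_kernel_reflect_left:
  assumes "i \<in> {1..n}" "j \<in> {1..n}"
  shows "bridge_kernel n (reflect 2 n i) j = bridge_kernel n i (reflect 2 n j)"
proof -
  have "reflect 2 n j \<in> {1..n}" "reflect 2 n (reflect 2 n j) = j"
    using assms(2) by (auto simp: reflect_def)
  then show ?thesis
    using bridge_kernel_reflect_reflect[of i n "reflect 2 n j"] assms(1) by simp
qed

text \<open>Supplies \<open>reflect_le\<close> in the lower half and also strictness: the product is
  positive if \<open>1 < min i j\<close> and \<open>2 * max i j < n + 2\<close>.\<close>

lemma bridge_kernel_diff_reflect:
  assumes "i \<in> {1..n}" "j \<in> {1..n}" "2 * i \<le> n + 2" "2 * j \<le> n + 2"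
  shows "bridge_kernel n i j - bridge_kernel n (reflect 2 n i) j
    = (real (min i j) - 1) * (real n + 2 - 2 * real (max i j))"
  using assms(1)
proof (cases rule: reflect_cases)
  case i: 2
  \<comment> \<open>The reflected index is the larger one, and its distance to \<open>n + 1\<close>
    is \<open>i - 1\<close>.\<close>
  then have "j \<le> reflect 2 n i"
    using assms by linarith
  then have "bridge_kernel n (reflect 2 n i) j = (real i - 1) * (real j - 1)"
    using i by (simp add: bridge_kernel_commute[of n _ j] bridge_kernel_le)
  then show ?thesis
    by (auto simp: bridge_kernel_def max_def min_def algebra_simps)
qed (use assms(2) in \<open>auto simp: min_def\<close>)

text \<open>Invariance under reflecting both indices makes both sides of \<open>reflect_diff\<close>
  zero.\<close>

lemma folded_kernel_lower_half:
  "folded_kernel {1..n} (reflect 2 n) {i. 2 * i \<le> n + 2} (bridge_kernel n)"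
proof
  show "bridge_kernel n i j = bridge_kernel n j i" for i j
    by (rule bridge_kernel_commute)
  fix i j
  assume ij: "i \<in> {1..n}" "j \<in> {1..n}" "i \<in> {i. 2 * i \<le> n + 2}" "j \<in> {i. 2 * i \<le> n + 2}"
  then have "0 \<le> (real (min i j) - 1) * (real n + 2 - 2 * real (max i j))"
    by (intro mult_nonneg_nonneg) auto
  moreover have "bridge_kernel n i j - bridge_kernel n (reflect 2 n i) j
      = (real (min i j) - 1) * (real n + 2 - 2 * real (max i j))"
    using ij by (intro bridge_kernel_diff_reflect) auto
  ultimately show "bridge_kernel n (reflect 2 n i) j \<le> bridge_kernel n i j"
    by linarith
  show "\<bar>bridge_kernel n i (reflect 2 n j) - bridge_kernel n (reflect 2 n i) j\<bar>
      \<le> bridge_kernel n i j - bridge_kernel n (reflect 2 n i) (reflect 2 n j)"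
    using ij by (simp add: bridge_kernel_reflect_reflect bridge_kernel_reflect_left)
qed (auto simp: reflect_def)

section \<open>The inequalities for an optimal ordering\<close>

lemma is_ordering_inj_pos:
  assumes "0 < a 1" "strict_mono_on {1..n} a" "is_ordering n a c"
  shows "inj_on c {1..n}" and "\<And>i. i \<in> {1..n} \<Longrightarrow> 0 < c i"
    and "\<And>i. i \<in> {1..n} \<Longrightarrow> \<exists>k\<in>{1..n}. c i = a k"
proof -
  obtain p where p: "p permutes {1..n}" "\<And>i. i \<in> {1..n} \<Longrightarrow> c i = a (p i)"
    using assms(3) by (auto simp: is_ordering_def)
  have p_in: "p i \<in> {1..n}" if "i \<in> {1..n}" for i
    using permutes_in_image[OF p(1), of i] that by simp
  show "inj_on c {1..n}"
  proof (rule inj_onI)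
    fix i j assume ij: "i \<in> {1..n}" "j \<in> {1..n}" "c i = c j"
    then have "p i = p j"
      using strict_mono_on_imp_inj_on[OF assms(2)] p(2) p_in by (auto dest: inj_onD)
    then show "i = j"
      using permutes_inj[OF p(1)] by (auto dest: injD)
  qed
  show ex: "\<exists>k\<in>{1..n}. c i = a k" if "i \<in> {1..n}" for i
    using that p(2) p_in by blast
  show "0 < c i" if i: "i \<in> {1..n}" for i
  proof -
    obtain k where k: "k \<in> {1..n}" "c i = a k" using ex[OF i] by blast
    have "a 1 \<le> a k"
      using strict_mono_on_leD[OF assms(2), of 1 k] k by auto
    with k assms(1) show ?thesis by simp
  qed
qed

theorem theorem3:
  fixes n u u' :: nat and a c :: "nat \<Rightarrow> real"
  assumes "n \<ge> 2"
    and "0 < a 1" and "strict_mono_on {1..n} a"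
    and "u = nat \<lceil>real n / 2\<rceil>" and "u' = nat \<lfloor>real n / 2\<rfloor>"
    and "optimal_ordering n a c"
    and "c 1 = a 1" and "c n = a 2"
  shows "(even n \<longrightarrow>
            (\<forall>k. 2 \<le> k \<and> k \<le> u \<longrightarrow> c (n + 2 - k) < c k \<and> c k < c (n + 1 - k))) \<and>
         (odd n \<longrightarrow>
            (\<forall>k. 2 \<le> k \<and> k \<le> u' \<longrightarrow> c k < c (n + 1 - k)) \<and>
            (\<forall>k. 2 \<le> k \<and> k \<le> u \<longrightarrow> c (n + 2 - k) < c k))"
proof -
  have ord: "is_ordering n a c"
    using assms(6) by (simp add: optimal_ordering_def)
  note inj = is_ordering_inj_pos(1)[OF assms(2,3) ord]
    and pos = is_ordering_inj_pos(2)[OF assms(2,3) ord]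
    and val = is_ordering_inj_pos(3)[OF assms(2,3) ord]
  interpret upper: folded_kernel "{1..n}" "reflect 1 n" "{i. n + 1 \<le> 2 * i}" "bridge_kernel n"
    by (rule folded_kernel_upper_half)
  interpret lower: folded_kernel "{1..n}" "reflect 2 n" "{i. 2 * i \<le> n + 2}" "bridge_kernel n"
    by (rule folded_kernel_lower_half)
  have up: "c k < c (n + 1 - k)" if k: "1 \<le> k" "2 * k < n + 1" for k
  proof (rule ccontr)
    assume "\<not> c k < c (n + 1 - k)"
    moreover have "c k \<noteq> c (n + 1 - k)"
    proof
      assume "c k = c (n + 1 - k)"
      then have "k = n + 1 - k" by (rule inj_onD[OF inj]) (use k in auto)
      with k show False by simp
    qed
    ultimately have wrong: "c (n + 1 - k) < c k" by simp
    define i where "i = n + 1 - k"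
    have i: "i \<in> {1..n}" "n + 1 \<le> 2 * i" "reflect 1 n i = k" "real i = real n + 1 - real k"
      using k by (auto simp: i_def reflect_def of_nat_diff)
    \<comment> \<open>The right side exceeds the left by \<open>n + 1 - 2 * k\<close>.\<close>
    have "bridge_kernel n k k < bridge_kernel n i i"
      using k by (simp add: bridge_kernel_le i(4) algebra_simps)
    then have "quad_form {1..n} (bridge_kernel n) c
        < quad_form {1..n} (bridge_kernel n) (upper.polarize c)"
      using i wrong pos by (intro upper.less_polarize_of_wrong_pair[of c i]) (auto simp: i_def)
    then show False
      using optimal_ordering_not_less_polarize[OF upper.folding_axioms assms(6)] by simp
  qed
  have low: "c (n + 2 - k) < c k" if k: "2 \<le> k" "2 * k < n + 2" for k
  proof (rule ccontr)
    assume "\<not> c (n + 2 - k) < c k"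
    moreover have "c k \<noteq> c (n + 2 - k)"
    proof
      assume "c k = c (n + 2 - k)"
      then have "k = n + 2 - k" by (rule inj_onD[OF inj]) (use k in auto)
      with k show False by simp
    qed
    ultimately have wrong: "c k < c (n + 2 - k)" by simp
    have n: "3 \<le> n" using k by simp
    obtain m where m: "m \<in> {1..n}" "c 2 = a m"
      using val[of 2] n by auto
    \<comment> \<open>By \<open>3 \<le> n\<close> the positions 1, 2 and \<open>n\<close> are
      distinct, so \<open>c 2\<close> is neither \<open>a 1\<close> nor \<open>a 2\<close>.\<close>
    have "m \<noteq> 1" "m \<noteq> 2"
      using inj_onD[OF inj, of 2 1] inj_onD[OF inj, of 2 n] m n assms(7,8) by auto
    then have "a 2 < a m"
      using m n by (intro strict_mono_onD[OF assms(3)]) auto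
    then have right: "c (reflect 2 n 2) < c 2"
      using m n assms(8) by (simp add: reflect_def)
    \<comment> \<open>Since \<open>2 \<le> k\<close>, the difference is
      \<open>(2 - 1) * (n + 2 - 2 * k)\<close>.\<close>
    have "bridge_kernel n (reflect 2 n 2) k < bridge_kernel n 2 k"
      using bridge_kernel_diff_reflect[of 2 n k] k n by (simp add: min_def max_def)
    then have "quad_form {1..n} (bridge_kernel n) c
        < quad_form {1..n} (bridge_kernel n) (lower.polarize c)"
      using wrong right pos k n
      by (intro lower.less_polarize_of_mixed_pairs[of c 2 k] bridge_kernel_reflect_reflect)
        (auto simp: reflect_def)
    then show False
      using optimal_ordering_not_less_polarize[OF lower.folding_axioms assms(6)] by simp
  qed
  \<comment> \<open>These bounds keep \<open>k\<close> strictly below the centre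
    \<open>(n + 1) / 2\<close> or \<open>(n + 2) / 2\<close> of the reflection in question. For odd
    \<open>n\<close>, \<open>k = u\<close> is the centre of the first one and occurs only with the
    second.\<close>
  have u: "2 * u \<le> n + 1" "even n \<Longrightarrow> 2 * u \<le> n" and u': "2 * u' \<le> n"
    unfolding assms(4,5) by (auto elim!: evenE) linarith+
  show ?thesis
  proof (intro conjI impI allI)
    fix k assume "even n" and k: "2 \<le> k \<and> k \<le> u"
    then show "c (n + 2 - k) < c k" "c k < c (n + 1 - k)"
      using u(2) by (intro low up; linarith)+
  next
    fix k assume "2 \<le> k \<and> k \<le> u'"
    then show "c k < c (n + 1 - k)"
      using u' by (intro up) linarith+
  next
    fix k assume "2 \<le> k \<and> k \<le> u"
    then show "c (n + 2 - k) < c k"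
      using u(1) by (intro low) linarith+
  qed
qed

end
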